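(* Let $(\xi_n)_{n\in\mathbb{N}}$ be a sequence of independent identically distributed Bernoulli random variables satisfying $\Pr(\xi_n=1)=\Pr(\xi_n=0)=1/2$ for each $n\in\mathbb{N}$, and let $\mathcal{D}=\{n\in\mathbb{Z} : \xi_{|n|}=1\}$ (a random symmetric subset of $\mathbb{Z}$). Then $$\Pr(\mathcal{D}\text{ is additively } \mathbb{Z}\text{-decomposable})=1.$$
   Context: Here $\mathbb{N}=\{0,1,2,\ldots\}$. For $\mathcal{A},\mathcal{B}\subset\mathbb{Z}$, $\mathcal{A}+\mathcal{B}=\{a+b : (a,b)\in\mathcal{A}\times\mathcal{B}\}$. A set $\mathcal{C}\subset\mathbb{Z}$ is called additively $\mathbb{Z}$-decomposable if there exist sets $\mathcal{A},\mathcal{B}\subset\mathbb{Z}$ of cardinality at least two each such that $\mathcal{C}=\mathcal{A}+\mathcal{B}$. *)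

theory Defs
  imports "HOL-Probability.Probability" "HOL-Library.Set_Algebras"
begin

(* The library's card is 0 on infinite sets, so infinite sets are admitted explicitly. *)
definition at_least_two :: "'a set \<Rightarrow> bool" where
  "at_least_two A \<longleftrightarrow> infinite A \<or> card A \<ge> 2"

(* Addition of sets is the elementwise sum from HOL-Library.Set_Algebras. *)
definition additively_Z_decomposable :: "int set \<Rightarrow> bool" where
  "additively_Z_decomposable C \<longleftrightarrow>
     (\<exists>A B. at_least_two A \<and> at_least_two B \<and> C = A + B)"

definition random_symmetric_set :: "(nat \<Rightarrow> 'a \<Rightarrow> real) \<Rightarrow> 'a \<Rightarrow> int set" where
  "random_symmetric_set \<xi> \<omega> = {n. \<xi> (nat \<bar>n\<bar>) \<omega> = 1}"

end

theory Submission
  imports Defs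
begin

text \<open>
  The idea is that the summands may use integers of both signs, so that a prescribed \<open>n\<close> in \<open>\<D>\<close>
  can be written as \<open>n = a + b\<close> with \<open>a\<close> far out to the right and \<open>b = n - a\<close> far out to the left.
  If finite sets \<open>A\<close> and \<open>B\<close> with \<open>A + B \<subseteq> \<D>\<close> have already been built, then \<open>a\<close> may be added to
  \<open>A\<close> and \<open>n - a\<close> to \<open>B\<close> as soon as \<open>a + B \<subseteq> \<D>\<close> and \<open>n - a + A \<subseteq> \<D>\<close>. As \<open>\<D>\<close> is symmetric, the
  second condition reads \<open>a + (- n - A) \<subseteq> \<D>\<close>, so the two together ask that one finite set,
  \<open>B \<union> (- n - A)\<close>, have its translate by \<open>a\<close> inside \<open>\<D>\<close>. Going through all \<open>n \<in> \<D>\<close> in turn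
  decomposes every symmetric set that contains infinitely many translates of each finite set
  (\<open>decomposable_if_infinitely_many_translates\<close>).

  Almost surely \<open>\<D>\<close> has that property: disjoint blocks of \<open>K\<close> consecutive variables \<open>\<xi>\<^sub>i\<close> are
  independent, each consists of ones with the same probability \<open>2\<^sup>-\<^sup>K\<close>, so almost surely
  infinitely many do (\<open>AE_infinitely_many_blocks_of_ones\<close>), and a long block of ones contains a
  translate of a given finite set (\<open>infinitely_many_translates_if_blocks_of_ones\<close>).
\<close>

section \<open>Decomposing symmetric sets that are rich in translates\<close>

lemma at_least_twoI:
  assumes "x \<in> A" "y \<in> A" "x \<noteq> y"
  shows "at_least_two A"
proof (cases "finite A")
  case True
  then have "card {x, y} \<le> card A"
    using assms by (intro card_mono) auto
  then show ?thesis
    using assms by (simp add: at_least_two_def)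
qed (simp add: at_least_two_def)

text \<open>
  The summands are \<open>A = {a\<^sub>0, a\<^sub>1, \<dots>}\<close> and \<open>B = {b\<^sub>0, b\<^sub>1, \<dots>}\<close> with \<open>b\<^sub>n = e\<^sub>n - a\<^sub>n\<close>, where
  \<open>e\<close> enumerates \<open>D\<close>. The diagonal sums \<open>a\<^sub>n + b\<^sub>n\<close> then exhaust \<open>D\<close>, and \<open>a\<^sub>n\<close> is chosen by
  recursion so that the other sums also stay in \<open>D\<close>. Requiring new elements at every step
  makes both summands infinite even if the enumeration has repetitions.
\<close>

lemma decomposable_if_infinitely_many_translates:
  fixes D :: "int set"
  assumes sym: "\<And>n. n \<in> D \<Longrightarrow> - n \<in> D"
    and translates: "\<And>S. finite S \<Longrightarrow> infinite {a. \<forall>s\<in>S. a + s \<in> D}"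
  shows "additively_Z_decomposable D"
proof -
  have "D \<noteq> {}"
    using translates[of "{0}"] by auto
  define e where "e = from_nat_into D"
  have range_e: "range e = D"
    unfolding e_def using \<open>D \<noteq> {}\<close> by (rule range_from_nat_into) auto
  define P where "P a n r \<longleftrightarrow>
      (\<forall>k<n. r + (e k - a k) \<in> D \<and> a k + (e n - r) \<in> D \<and> r \<noteq> a k \<and> e n - r \<noteq> e k - a k)"
    for a :: "nat \<Rightarrow> int" and n r
  have "\<exists>a. \<forall>n. P a n (a n)"
  proof (rule dependent_wellorder_choice)
    fix r n and a a' :: "nat \<Rightarrow> int"
    assume "\<And>k. k < n \<Longrightarrow> a k = a' k"
    then show "P a n r = P a' n r"
      by (simp add: P_def)
  next
    fix n :: nat and a :: "nat \<Rightarrow> int"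
    \<comment> \<open>By symmetry \<open>a\<^sub>k + b\<^sub>n \<in> D\<close> amounts to \<open>a\<^sub>n + (- e\<^sub>n - a\<^sub>k) \<in> D\<close>.\<close>
    define S where "S = (\<lambda>k. e k - a k) ` {..<n} \<union> (\<lambda>k. - e n - a k) ` {..<n}"
    \<comment> \<open>The values of \<open>a\<^sub>n\<close> for which \<open>a\<^sub>n\<close> or \<open>b\<^sub>n\<close> would repeat an earlier element.\<close>
    define T where "T = a ` {..<n} \<union> (\<lambda>k. e n - (e k - a k)) ` {..<n}"
    have "infinite ({r. \<forall>s\<in>S. r + s \<in> D} - T)"
      by (intro Diff_infinite_finite translates) (auto simp: S_def T_def)
    then obtain r where S: "\<And>s. s \<in> S \<Longrightarrow> r + s \<in> D" and T: "r \<notin> T"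
      using infinite_imp_nonempty by blast
    have "P a n r"
      unfolding P_def
    proof (intro allI impI conjI)
      fix k assume k: "k < n"
      show "r + (e k - a k) \<in> D"
        using k by (intro S) (auto simp: S_def)
      have "r + (- e n - a k) \<in> D"
        using k by (intro S) (auto simp: S_def)
      from sym[OF this] show "a k + (e n - r) \<in> D"
        by (simp add: algebra_simps)
      have "a k \<in> T" "e n - (e k - a k) \<in> T"
        using k by (auto simp: T_def)
      with T have "r \<noteq> a k" "r \<noteq> e n - (e k - a k)"
        by metis+
      then show "r \<noteq> a k" "e n - r \<noteq> e k - a k"
        by linarith+
    qed
    then show "\<exists>r. P a n r" ..
  qed
  then obtain a where a: "\<And>n. P a n (a n)"
    by blast
  define b where "b n = e n - a n" for n
  have sum_in: "a m + b n \<in> D" for m n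
  proof (cases m n rule: linorder_cases)
    case less
    then show ?thesis using a[of n] by (auto simp: P_def b_def)
  next
    case equal
    then show ?thesis using range_e by (auto simp: b_def)
  next
    case greater
    then show ?thesis using a[of m] by (auto simp: P_def b_def)
  qed
  have "D = range a + range b"
  proof
    show "D \<subseteq> range a + range b"
    proof
      fix x assume "x \<in> D"
      then obtain n where "x = a n + b n"
        using range_e by (force simp: b_def)
      then show "x \<in> range a + range b"
        by auto
    qed
    show "range a + range b \<subseteq> D"
      using sum_in by (auto elim!: set_plus_elim)
  qed
  moreover have "a 1 \<noteq> a 0" "b 1 \<noteq> b 0"
    using a[of 1] by (auto simp: P_def b_def)
  then have "at_least_two (range a)" "at_least_two (range b)"
    by (auto intro: at_least_twoI)
  ultimately show ?thesis
    unfolding additively_Z_decomposable_def by blast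
qed

text \<open>
  A finite set lies in some interval \<open>[-c, c]\<close>, which has \<open>2c + 1\<close> elements; if the \<open>m\<close>-th block
  of that length consists of ones, the translate by the centre of the block works.
\<close>

lemma infinitely_many_translates_if_blocks_of_ones:
  fixes S :: "int set"
  assumes blocks: "\<And>K. K > 0 \<Longrightarrow> infinite {m. \<forall>i\<in>{m * K..<m * K + K}. \<xi> i \<omega> = 1}"
    and "finite S"
  shows "infinite {a. \<forall>s\<in>S. a + s \<in> random_symmetric_set \<xi> \<omega>}"
proof -
  obtain c where "\<forall>s\<in>S. \<bar>s\<bar> \<le> c"
    using \<open>finite S\<close> by (metis finite_imageI finite_has_maximal2 Max_ge image_eqI)
  then have c: "\<bar>s\<bar> \<le> int (nat c)" if "s \<in> S" for s
    using that by force
  define K where "K = 2 * nat c + 1"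
  define centre where "centre m = int (m * K + nat c)" for m
  have "K > 0"
    by (simp add: K_def)
  then have "inj centre"
    by (auto simp: centre_def inj_def)
  moreover have "infinite {m. \<forall>i\<in>{m * K..<m * K + K}. \<xi> i \<omega> = 1}"
    using \<open>K > 0\<close> by (rule blocks)
  ultimately have "infinite (centre ` {m. \<forall>i\<in>{m * K..<m * K + K}. \<xi> i \<omega> = 1})"
    by (meson finite_imageD inj_on_subset subset_UNIV)
  moreover have "centre m + s \<in> random_symmetric_set \<xi> \<omega>"
    if "\<forall>i\<in>{m * K..<m * K + K}. \<xi> i \<omega> = 1" "s \<in> S" for m s
  proof -
    define i where "i = nat (int (nat c) + s)"
    have "centre m + s = int (m * K + i)" "i < K"
      using c[OF \<open>s \<in> S\<close>] by (auto simp: centre_def K_def i_def)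
    then have "nat \<bar>centre m + s\<bar> = m * K + i"
      by (simp only: abs_of_nat nat_int)
    then show ?thesis
      using that(1) \<open>i < K\<close> by (simp add: random_symmetric_set_def)
  qed
  ultimately show ?thesis
    by (elim contrapos_nn) (auto elim: finite_subset[rotated])
qed

section \<open>Long blocks of ones\<close>

context prob_space
begin

text \<open>
  By continuity from above, the event that infinitely many \<open>P m\<close> hold has probability
  at least \<open>p\<close>; for independent events the zero-one law raises this to one.
\<close>

lemma AE_infinitely_often_if_indep_events:
  fixes P :: "nat \<Rightarrow> 'a \<Rightarrow> bool"
  assumes indep: "indep_events (\<lambda>m. {x \<in> space M. P m x}) UNIV"
    and p: "p > 0" "\<And>m. \<P>(x in M. P m x) \<ge> p"
  shows "AE x in M. infinite {m. P m x}"
proof (rule ccontr)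
  assume "\<not> (AE x in M. infinite {m. P m x})"
  then have fin: "AE x in M. finite {m. P m x}"
    using borel_0_1_law_AE[OF indep] by blast
  have [measurable]: "{x \<in> space M. P m x} \<in> events" for m
    using indep by (auto simp: indep_events_def)
  define G where "G n = (\<Union>m\<in>{n..}. {x \<in> space M. P m x})" for n
  have [measurable]: "G n \<in> events" for n
    unfolding G_def by measurable
  have "(\<lambda>n. prob (G n)) \<longlonglongrightarrow> prob (\<Inter>n. G n)"
    by (rule finite_Lim_measure_decseq) (auto simp: decseq_def G_def intro: order_trans)
  moreover have "p \<le> prob (G n)" for n
    using p(2)[of n] by (rule order_trans) (intro finite_measure_mono, auto simp: G_def)
  ultimately have "p \<le> prob (\<Inter>n. G n)"
    by (intro LIMSEQ_le_const) auto
  moreover have "AE x in M. x \<notin> (\<Inter>n. G n)"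
    using fin
  proof eventually_elim
    case (elim x)
    then obtain n where "{m. P m x} \<subseteq> {..<n}"
      by (auto simp: finite_nat_iff_bounded)
    then have "x \<notin> G n"
      by (force simp: G_def)
    then show ?case by blast
  qed
  then have "prob (\<Inter>n. G n) = 0"
    by (subst prob_eq_0) auto
  ultimately show False
    using p(1) by simp
qed

lemma prob_all_ones_if_fair_bits:
  fixes \<xi> :: "nat \<Rightarrow> 'a \<Rightarrow> real"
  assumes indep: "indep_vars (\<lambda>_. borel) \<xi> UNIV"
    and half: "\<And>n. \<P>(\<omega> in M. \<xi> n \<omega> = 1) = 1/2"
    and "finite I"
  shows "\<P>(\<omega> in M. \<forall>i\<in>I. \<xi> i \<omega> = 1) = (1/2) ^ card I"
proof (cases "I = {}")
  case True
  then show ?thesis by (simp add: prob_space)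
next
  case False
  have one: "\<xi> i -` {1} \<inter> space M = {\<omega> \<in> space M. \<xi> i \<omega> = 1}" for i
    by auto
  have "{\<omega> \<in> space M. \<forall>i\<in>I. \<xi> i \<omega> = 1} = (\<Inter>i\<in>I. \<xi> i -` {1} \<inter> space M)"
    using False by auto
  also have "prob \<dots> = (\<Prod>i\<in>I. prob (\<xi> i -` {1} \<inter> space M))"
    using False \<open>finite I\<close> by (intro indep_varsD[OF indep]) auto
  finally show ?thesis
    by (simp add: one half)
qed

lemma AE_infinitely_many_blocks_of_ones:
  fixes \<xi> :: "nat \<Rightarrow> 'a \<Rightarrow> real"
  assumes indep: "indep_vars (\<lambda>_. borel) \<xi> UNIV"
    and half: "\<And>n. \<P>(\<omega> in M. \<xi> n \<omega> = 1) = 1/2"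
  shows "AE \<omega> in M. infinite {m. \<forall>i\<in>{m * K..<m * K + K}. \<xi> i \<omega> = 1}"
proof (rule AE_infinitely_often_if_indep_events)
  define block where "block m = {m * K..<m * K + K}" for m
  have disjoint: "block l \<inter> block m = {}" if "l \<noteq> m" for l m
  proof -
    have "i div K = n" if "i \<in> block n" for i n
      using that by (intro div_nat_eqI) (auto simp: block_def mult.commute)
    with \<open>l \<noteq> m\<close> show ?thesis by blast
  qed
  have prob: "\<P>(\<omega> in M. \<forall>i\<in>block m. \<xi> i \<omega> = 1) = (1/2) ^ K" for m
    using prob_all_ones_if_fair_bits[OF indep half, of "block m"] by (simp add: block_def)
  have [measurable]: "\<xi> i \<in> borel_measurable M" for i
    using indep by (auto simp: indep_vars_def)
  have "indep_events (\<lambda>m. {\<omega> \<in> space M. \<forall>i\<in>block m. \<xi> i \<omega> = 1}) UNIV"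
    unfolding indep_events_def
  proof (intro conjI allI impI)
    show "range (\<lambda>m. {\<omega> \<in> space M. \<forall>i\<in>block m. \<xi> i \<omega> = 1}) \<subseteq> events"
      by (auto simp: block_def)
    fix J :: "nat set" assume J: "J \<noteq> {}" "finite J"
    have "(\<Inter>m\<in>J. {\<omega> \<in> space M. \<forall>i\<in>block m. \<xi> i \<omega> = 1})
        = {\<omega> \<in> space M. \<forall>i\<in>(\<Union>m\<in>J. block m). \<xi> i \<omega> = 1}"
      using J by auto
    also have "prob \<dots> = (1/2) ^ card (\<Union>m\<in>J. block m)"
      using J by (intro prob_all_ones_if_fair_bits[OF indep half]) (auto simp: block_def)
    also have "card (\<Union>m\<in>J. block m) = (\<Sum>m\<in>J. card (block m))"
      using J disjoint by (intro card_UN_disjoint) (auto simp: block_def)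
    also have "(1/2) ^ \<dots> = (\<Prod>m\<in>J. \<P>(\<omega> in M. \<forall>i\<in>block m. \<xi> i \<omega> = 1))"
      unfolding prob by (simp add: block_def power_mult[symmetric] mult.commute)
    finally show "prob (\<Inter>m\<in>J. {\<omega> \<in> space M. \<forall>i\<in>block m. \<xi> i \<omega> = 1})
        = (\<Prod>m\<in>J. \<P>(\<omega> in M. \<forall>i\<in>block m. \<xi> i \<omega> = 1))" .
  qed
  then show "indep_events (\<lambda>m. {\<omega> \<in> space M. \<forall>i\<in>{m * K..<m * K + K}. \<xi> i \<omega> = 1}) UNIV"
    by (simp add: block_def)
  show "\<P>(\<omega> in M. \<forall>i\<in>{m * K..<m * K + K}. \<xi> i \<omega> = 1) \<ge> (1/2) ^ K" for m
    using prob[of m] by (simp add: block_def)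
qed simp

end

section \<open>Random symmetric sets are decomposable\<close>

theorem theorem1:
  fixes M :: "'a measure" and \<xi> :: "nat \<Rightarrow> 'a \<Rightarrow> real"
  assumes "prob_space M"
    and "prob_space.indep_vars M (\<lambda>_. borel) \<xi> UNIV"
    and "\<And>n. \<P>(\<omega> in M. \<xi> n \<omega> = 1) = 1/2"
    and "\<And>n. \<P>(\<omega> in M. \<xi> n \<omega> = 0) = 1/2"
  shows "AE \<omega> in M. additively_Z_decomposable (random_symmetric_set \<xi> \<omega>)"
proof -
  interpret prob_space M by fact
  have "AE \<omega> in M. \<forall>K. infinite {m. \<forall>i\<in>{m * K..<m * K + K}. \<xi> i \<omega> = 1}"
    using AE_infinitely_many_blocks_of_ones[OF assms(2,3)] by (simp add: AE_all_countable)
  then show ?thesis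
  proof eventually_elim
    case (elim \<omega>)
    show ?case
    proof (rule decomposable_if_infinitely_many_translates)
      show "- n \<in> random_symmetric_set \<xi> \<omega>" if "n \<in> random_symmetric_set \<xi> \<omega>" for n
        using that by (simp add: random_symmetric_set_def)
      show "infinite {a. \<forall>s\<in>S. a + s \<in> random_symmetric_set \<xi> \<omega>}" if "finite S" for S
        using elim that by (intro infinitely_many_translates_if_blocks_of_ones) auto
    qed
  qed
qed

end
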